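(* Let $G$ be a finite simple connected graph and $T$ its toll walk transit function. Then $T$ satisfies Axioms (JC) and (tr) on $G$ if and only if $G$ is a tree.
   Context: In a finite simple graph $G$, a walk $W=w_1w_2\cdots w_k$ ($k\ge 2$) is a toll walk if $w_1\neq w_k$, $w_2$ is the only neighbor of $w_1$ among the vertices of $W$, and $w_{k-1}$ is the only neighbor of $w_k$ among the vertices of $W$. The toll walk transit function $T$ of $G$ is given by $T(u,u)=\{u\}$ and, for $u\ne v$, $T(u,v)$ is the set of all vertices lying on some toll walk from $u$ to $v$. Axioms for $R=T$ on $V=V(G)$: (JC) For all pairwise distinct $u,x,y,v\in V$: if $x\in R(u,y)$, $y\in R(x,v)$ and $R(x,y)=\{x,y\}$, then $x\in R(u,v)$. (tr) For all $u,v,x\in V$ with $u\neq v$: if $R(u,x)=\{u,x\}$ and $R(x,v)=\{x,v\}$, then $x\in R(u,v)$. *)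

theory Defs
  imports "Graph_Theory.Graph_Theory"
begin

definition toll_walk :: "('a,'b) pre_digraph \<Rightarrow> 'a vwalk \<Rightarrow> bool" where
  "toll_walk G W \<longleftrightarrow>
     vwalk W G \<and> length W \<ge> 2 \<and> hd W \<noteq> last W \<and>
     {z \<in> set W. hd W \<rightarrow>\<^bsub>G\<^esub> z} = {W ! 1} \<and>
     {z \<in> set W. last W \<rightarrow>\<^bsub>G\<^esub> z} = {W ! (length W - 2)}"

definition toll_transit :: "('a,'b) pre_digraph \<Rightarrow> 'a \<Rightarrow> 'a \<Rightarrow> 'a set" where
  "toll_transit G u v =
     (if u = v then {u}
      else {x. \<exists>W. toll_walk G W \<and> hd W = u \<and> last W = v \<and> x \<in> set W})"

definition axiom_JC :: "'a set \<Rightarrow> ('a \<Rightarrow> 'a \<Rightarrow> 'a set) \<Rightarrow> bool" where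
  "axiom_JC V R \<longleftrightarrow>
     (\<forall>u\<in>V. \<forall>x\<in>V. \<forall>y\<in>V. \<forall>v\<in>V. distinct [u, x, y, v] \<longrightarrow>
        x \<in> R u y \<longrightarrow> y \<in> R x v \<longrightarrow> R x y = {x, y} \<longrightarrow> x \<in> R u v)"

definition axiom_tr :: "'a set \<Rightarrow> ('a \<Rightarrow> 'a \<Rightarrow> 'a set) \<Rightarrow> bool" where
  "axiom_tr V R \<longleftrightarrow>
     (\<forall>u\<in>V. \<forall>v\<in>V. \<forall>x\<in>V. u \<noteq> v \<longrightarrow>
        R u x = {u, x} \<longrightarrow> R x v = {x, v} \<longrightarrow> x \<in> R u v)"

text \<open>
  A simple undirected graph is represented by the locale predicate \<^const>\<open>graph\<close>, i.e. as a
  symmetric digraph. The library's \<open>pre_digraph.cycle\<close> (and hence \<open>forest\<close> and \<open>tree\<close>) counts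
  the closed walk \<open>a, b, a\<close> as a cycle, so in a symmetric digraph it does not express
  undirected acyclicity. An undirected cycle needs at least three distinct vertices.
\<close>

definition undirected_cycle :: "('a,'b) pre_digraph \<Rightarrow> 'a vwalk \<Rightarrow> bool" where
  "undirected_cycle G C \<longleftrightarrow> vpath C G \<and> length C \<ge> 3 \<and> last C \<rightarrow>\<^bsub>G\<^esub> hd C"

definition undirected_tree :: "('a,'b) pre_digraph \<Rightarrow> bool" where
  "undirected_tree G \<longleftrightarrow> connected G \<and> \<not> (\<exists>C. undirected_cycle G C)"

end

theory Submission
  imports Defs
begin

text \<open>
  Adjacent vertices are exactly the pairs of distinct vertices with trivial toll interval, and a
  path is a toll walk unless a chord at one of its ends closes a cycle no longer than the path.
  Given a shortest cycle \<open>u x y \<dots> v\<close>, axiom (tr) fails on it if it is a triangle; otherwise the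
  paths \<open>u x y\<close> and \<open>x y \<dots> v\<close> are toll walks, while \<open>x\<close> is not in the interval of the adjacent
  vertices \<open>u\<close> and \<open>v\<close>, against (JC). Conversely, the premises of (JC) provide a path
  from \<open>u\<close> to \<open>x\<close> avoiding \<open>y\<close> and a path from \<open>y\<close> to \<open>v\<close> avoiding \<open>x\<close>; without cycles
  the two are disjoint and the edge \<open>xy\<close> joins them to a path, hence to a toll walk.
\<close>

section \<open>Walks and paths in symmetric digraphs\<close>

text \<open>Serves to confine a toll walk between adjacent vertices to its two ends. Closure is
  demanded only for successors on the walk, since the toll condition restricts no other
  neighbours.\<close>

lemma set_vwalk_subset_closed:
  assumes "vwalk p G" "hd p \<in> S"
    and "\<And>a b. a \<in> S \<Longrightarrow> b \<in> set p \<Longrightarrow> a \<rightarrow>\<^bsub>G\<^esub> b \<Longrightarrow> b \<in> S"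
  shows "set p \<subseteq> S"
  using assms
proof (induction p rule: vwalk_induct)
  case (Cons u v p)
  from Cons(1,3) have "v \<in> S"
    by (intro Cons(4)[of u v]) simp_all
  moreover have "set (v # p) \<subseteq> S"
  proof (rule Cons(2))
    show "hd (v # p) \<in> S"
      using \<open>v \<in> S\<close> by simp
    show "b \<in> S" if "a \<in> S" "b \<in> set (v # p)" "a \<rightarrow>\<^bsub>G\<^esub> b" for a b
      using that by (intro Cons(4)[of a b]) simp_all
  qed
  ultimately show ?case
    using Cons(3) by simp
qed simp

lemma vwalk_append:
  assumes "vwalk p G" "vwalk q G" "last p \<rightarrow>\<^bsub>G\<^esub> hd q"
  shows "vwalk (p @ q) G"
  using assms by (auto simp: vwalk_def vwalk_arcs_append)

lemma vpath_rev:
  assumes "symmetric G" "vpath p G"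
  shows "vpath (rev p) G"
  using assms by (auto simp: vpath_def vwalk_rev_ex)

text \<open>A second neighbour \<open>z\<close> of the head on \<open>P\<close> would close the
  segment of \<open>P\<close> up to \<open>z\<close> to a cycle no longer than \<open>P\<close>.
  Bounding cycle lengths instead of forbidding cycles lets the lemma serve both acyclic graphs and
  short paths along a shortest cycle.\<close>

lemma neighbours_hd_vpath:
  assumes "symmetric G" "vpath P G" "length P \<ge> 2"
    and no_cycle: "\<And>C. undirected_cycle G C \<Longrightarrow> length C > length P"
    and loopfree: "\<not> hd P \<rightarrow>\<^bsub>G\<^esub> hd P"
  shows "{z \<in> set P. hd P \<rightarrow>\<^bsub>G\<^esub> z} = {P ! 1}"
proof -
  obtain a b R where P: "P = a # b # R"
    using assms(3) by (cases P; cases "tl P") auto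
  have ab: "a \<rightarrow>\<^bsub>G\<^esub> b"
    using assms(2) P by (auto simp: vpath_def vwalk_def)
  have "z = b" if z: "z \<in> set P" "a \<rightarrow>\<^bsub>G\<^esub> z" for z
  proof (rule ccontr)
    assume "z \<noteq> b"
    then have "z \<in> set R"
      using z loopfree P by auto
    then obtain A B where R: "R = A @ z # B"
      by (meson split_list)
    have "vwalk ((a # b # A @ [z]) @ B) G"
      using assms(2) P R by (simp add: vpath_def)
    then have "vwalk (a # b # A @ [z]) G"
      by (rule vwalkI_append_l[rotated]) simp
    moreover have "z \<rightarrow>\<^bsub>G\<^esub> a"
      using z assms(1) by (blast intro: arcs_ends_symmetric)
    ultimately have "undirected_cycle G (a # b # A @ [z])"
      using assms(2) P R by (auto simp: undirected_cycle_def vpath_def)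
    from no_cycle[OF this] show False
      using P R by simp
  qed
  then show ?thesis
    using ab P by auto
qed

text \<open>The definition names the only neighbour of an end by its position; here any neighbour
  found on the walk takes over that role.\<close>

lemma toll_walk_only_neighbour:
  assumes "toll_walk G W" "z \<in> set W"
  shows "hd W \<rightarrow>\<^bsub>G\<^esub> z \<Longrightarrow> {w \<in> set W. hd W \<rightarrow>\<^bsub>G\<^esub> w} = {z}"
    and "last W \<rightarrow>\<^bsub>G\<^esub> z \<Longrightarrow> {w \<in> set W. last W \<rightarrow>\<^bsub>G\<^esub> w} = {z}"
proof -
  have N: "{w \<in> set W. hd W \<rightarrow>\<^bsub>G\<^esub> w} = {W ! 1}"
    "{w \<in> set W. last W \<rightarrow>\<^bsub>G\<^esub> w} = {W ! (length W - 2)}"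
    using assms(1) by (simp_all add: toll_walk_def)
  show "{w \<in> set W. hd W \<rightarrow>\<^bsub>G\<^esub> w} = {z}" if "hd W \<rightarrow>\<^bsub>G\<^esub> z"
  proof -
    have "z \<in> {w \<in> set W. hd W \<rightarrow>\<^bsub>G\<^esub> w}"
      using assms(2) that by simp
    then show ?thesis
      unfolding N by simp
  qed
  show "{w \<in> set W. last W \<rightarrow>\<^bsub>G\<^esub> w} = {z}" if "last W \<rightarrow>\<^bsub>G\<^esub> z"
  proof -
    have "z \<in> {w \<in> set W. last W \<rightarrow>\<^bsub>G\<^esub> w}"
      using assms(2) that by simp
    then show ?thesis
      unfolding N by simp
  qed
qed

section \<open>Toll walks and toll intervals in a simple graph\<close>

context graph
begin

lemma not_adj_self: "\<not> u \<rightarrow>\<^bsub>G\<^esub> u"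
  using no_loops by (auto simp: arcs_ends_conv)

lemma adj_sym: "u \<rightarrow>\<^bsub>G\<^esub> v \<Longrightarrow> v \<rightarrow>\<^bsub>G\<^esub> u"
  by (rule arcs_ends_symmetric[OF sym_arcs])

lemma toll_walk_vpath:
  assumes "vpath P G" "length P \<ge> 2"
    and no_cycle: "\<And>C. undirected_cycle G C \<Longrightarrow> length C > length P"
  shows "toll_walk G P"
proof -
  \<comment> \<open>The far end is the head of the reversed path, which has the same length and is a
    path by symmetry.\<close>
  have "{z \<in> set P. last P \<rightarrow>\<^bsub>G\<^esub> z} = {rev P ! 1}"
    using neighbours_hd_vpath[of G "rev P"] vpath_rev[of G P] assms
    by (auto simp: not_adj_self hd_rev)
  moreover have "rev P ! 1 = P ! (length P - 2)"
    using assms(2) by (simp add: rev_nth numeral_2_eq_2)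
  moreover have "hd P \<noteq> last P"
    using assms(1,2) by (cases P) (auto simp: vpath_def)
  moreover have "{z \<in> set P. hd P \<rightarrow>\<^bsub>G\<^esub> z} = {P ! 1}"
    using neighbours_hd_vpath[OF sym_arcs] assms not_adj_self by blast
  ultimately show ?thesis
    using assms(1,2) by (simp add: toll_walk_def vpath_def)
qed

lemma toll_transit_vpathI:
  assumes "vpath P G" "length P \<ge> 2"
    and "\<And>C. undirected_cycle G C \<Longrightarrow> length C > length P"
    and "hd P = u" "last P = v" "x \<in> set P"
  shows "x \<in> toll_transit G u v"
proof -
  have "toll_walk G P"
    using assms by (intro toll_walk_vpath)
  moreover from this have "u \<noteq> v"
    using assms by (auto simp: toll_walk_def)
  ultimately show ?thesis
    using assms by (auto simp: toll_transit_def)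
qed

text \<open>Each end is the only neighbour of the other on any toll walk from \<open>u\<close> to
  \<open>v\<close>, so such a walk never leaves \<open>{u, v}\<close>.\<close>

lemma toll_transit_adj:
  assumes "u \<rightarrow>\<^bsub>G\<^esub> v"
  shows "toll_transit G u v = {u, v}"
proof -
  have "u \<noteq> v" "u \<in> verts G" "v \<in> verts G"
    using assms not_adj_self by (auto dest: adj_in_verts)
  have "toll_walk G [u, v]"
    using assms adj_sym[OF assms] \<open>u \<noteq> v\<close> not_adj_self
    by (auto simp: toll_walk_def vwalk_def dest: adj_in_verts)
  moreover have "set W \<subseteq> {u, v}" if W: "toll_walk G W" "hd W = u" "last W = v" for W
  proof (rule set_vwalk_subset_closed)
    show "vwalk W G" "hd W \<in> {u, v}"
      using W by (auto simp: toll_walk_def)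
    have "W \<noteq> []"
      using W by (auto simp: toll_walk_def)
    then have "u \<in> set W" "v \<in> set W"
      using W by auto
    then have "{z \<in> set W. u \<rightarrow>\<^bsub>G\<^esub> z} = {v}" "{z \<in> set W. v \<rightarrow>\<^bsub>G\<^esub> z} = {u}"
      using toll_walk_only_neighbour[OF W(1)] W(2,3) assms adj_sym[OF assms] by auto
    then show "b \<in> {u, v}" if "a \<in> {u, v}" "b \<in> set W" "a \<rightarrow>\<^bsub>G\<^esub> b" for a b
      using that by auto
  qed
  ultimately show ?thesis
    using \<open>u \<noteq> v\<close> by (fastforce simp: toll_transit_def)
qed

text \<open>The second vertex of a toll walk from \<open>u\<close> to \<open>v\<close> lies in
  \<open>{u, v}\<close> and, there being no loops, must be \<open>v\<close>.\<close>

lemma toll_transit_eq_imp_adj: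
  assumes "toll_transit G u v = {u, v}" "u \<noteq> v"
  shows "u \<rightarrow>\<^bsub>G\<^esub> v"
proof -
  from assms obtain W where W: "toll_walk G W" "hd W = u" "last W = v"
    by (auto simp: toll_transit_def)
  then have "set W \<subseteq> {u, v}"
    using assms by (auto simp: toll_transit_def)
  moreover have "W ! 1 \<in> set W \<and> u \<rightarrow>\<^bsub>G\<^esub> (W ! 1)"
    using W by (auto simp: toll_walk_def)
  ultimately show ?thesis
    using not_adj_self by auto
qed

text \<open>The first occurrence of \<open>y\<close> on the walk is preceded by its only neighbour \<open>x\<close>.\<close>

lemma vpath_to_only_neighbour:
  assumes "vwalk W G" "hd W \<noteq> last W" "last W = y" "{z \<in> set W. y \<rightarrow>\<^bsub>G\<^esub> z} = {x}"
  shows "\<exists>P. vpath P G \<and> hd P = hd W \<and> last P = x \<and> y \<notin> set P"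
proof -
  have "W \<noteq> []"
    using assms(1) by auto
  then obtain A B where W: "W = A @ y # B" and y: "y \<notin> set A"
    using assms(3) by (metis last_in_set split_list_first)
  then have A: "A \<noteq> []"
    using assms(2,3) by auto
  then have "vwalk A G"
    using assms(1) W by (auto intro: vwalkI_append_l)
  have "last A \<rightarrow>\<^bsub>G\<^esub> y"
    using assms(1) W A by (simp add: vwalk_def vwalk_arcs_append)
  then have "last A \<in> {z \<in> set W. y \<rightarrow>\<^bsub>G\<^esub> z}"
    using W A by (auto intro: adj_sym)
  then have "last A = x"
    using assms(4) by auto
  moreover have "hd A = hd W"
    using W A by simp
  ultimately show ?thesis
    using vwalk_to_vpath_vpath[OF \<open>vwalk A G\<close>] y
    by (intro exI[of _ "vwalk_to_vpath A"])
      (auto simp: vwalk_to_vpath_hd vwalk_to_vpath_last dest: vwalk_to_vpath_subset)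
qed

text \<open>On a toll walk from \<open>u\<close> to \<open>y\<close> through \<open>x\<close>, the
  edge \<open>xy\<close> makes \<open>x\<close> the only neighbour of \<open>y\<close>, so the walk
  reaches \<open>x\<close> just before its first visit to \<open>y\<close>.\<close>

lemma toll_transit_vpath_left:
  assumes "x \<in> toll_transit G u y" "u \<noteq> y" "x \<rightarrow>\<^bsub>G\<^esub> y"
  shows "\<exists>P. vpath P G \<and> hd P = u \<and> last P = x \<and> y \<notin> set P"
proof -
  obtain W where W: "toll_walk G W" "hd W = u" "last W = y" "x \<in> set W"
    using assms by (auto simp: toll_transit_def)
  then have "{z \<in> set W. y \<rightarrow>\<^bsub>G\<^esub> z} = {x}"
    using toll_walk_only_neighbour(2)[OF W(1,4)] adj_sym[OF assms(3)] by simp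
  then show ?thesis
    using vpath_to_only_neighbour[of W y x] W assms(2) by (auto simp: toll_walk_def)
qed

lemma toll_transit_vpath_right:
  assumes "y \<in> toll_transit G x v" "x \<noteq> v" "x \<rightarrow>\<^bsub>G\<^esub> y"
  shows "\<exists>P. vpath P G \<and> hd P = y \<and> last P = v \<and> x \<notin> set P"
proof -
  obtain W where W: "toll_walk G W" "hd W = x" "last W = v" "y \<in> set W"
    using assms by (auto simp: toll_transit_def)
  then have vw: "vwalk (rev W) G" "W \<noteq> []"
    by (auto simp: toll_walk_def intro: vwalk_rev_ex)
  have "{z \<in> set (rev W). x \<rightarrow>\<^bsub>G\<^esub> z} = {y}"
    using toll_walk_only_neighbour(1)[OF W(1,4)] W(2) assms(3) by simp
  then obtain P where P: "vpath P G" "hd P = v" "last P = y" "x \<notin> set P"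
    using vpath_to_only_neighbour[of "rev W" x y] W vw assms(2) by (auto simp: hd_rev last_rev)
  then show ?thesis
    using vpath_rev[OF sym_arcs P(1)] by (intro exI[of _ "rev P"]) (auto simp: hd_rev last_rev)
qed

section \<open>From acyclicity to the axioms\<close>

text \<open>If \<open>z\<close> is the first vertex of \<open>Q\<close> on \<open>P\<close>, then
  \<open>P\<close> from \<open>z\<close> to \<open>x\<close>, the edge \<open>xy\<close> and
  \<open>Q\<close> from \<open>y\<close> back to \<open>z\<close> form a cycle.\<close>

lemma acyclic_disjoint_vpaths:
  assumes acyclic: "\<nexists>C. undirected_cycle G C"
    and P: "vpath P G" "last P = x" "y \<notin> set P"
    and Q: "vpath Q G" "hd Q = y" "x \<notin> set Q"
    and xy: "x \<rightarrow>\<^bsub>G\<^esub> y"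
  shows "set P \<inter> set Q = {}"
proof (rule ccontr)
  assume "set P \<inter> set Q \<noteq> {}"
  then obtain Q1 z Q2 where Qz: "Q = Q1 @ z # Q2" "z \<in> set P" "\<forall>w \<in> set Q1. w \<notin> set P"
    using split_list_first_prop[of Q "\<lambda>w. w \<in> set P"] by blast
  then obtain P1 P2 where Pz: "P = P1 @ z # P2"
    by (meson split_list)
  \<comment> \<open>Since \<open>y\<close> is not on \<open>P\<close> and \<open>x\<close> is not on
    \<open>Q\<close>, \<open>z\<close> differs from both, which gives the cycle its three
    vertices.\<close>
  have Q1: "Q1 \<noteq> []"
    using Qz Q(2) P(3) by auto
  have P2: "P2 \<noteq> []"
    using Pz P(2) Q(3) Qz(1) by auto
  have "vwalk (z # P2) G"
    using P(1) Pz by (auto simp: vpath_def intro: vwalkI_append_r[of _ P1])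
  moreover have "vwalk Q1 G"
    using Q(1) Qz(1) Q1 by (auto simp: vpath_def intro: vwalkI_append_l)
  moreover have "last (z # P2) \<rightarrow>\<^bsub>G\<^esub> hd Q1"
    using P(2) Pz Q(2) Qz(1) Q1 xy by simp
  ultimately have "vwalk ((z # P2) @ Q1) G"
    by (rule vwalk_append)
  \<comment> \<open>The choice of \<open>z\<close> as the first common vertex along \<open>Q\<close>
    keeps \<open>Q1\<close> off \<open>P\<close>.\<close>
  moreover have "distinct ((z # P2) @ Q1)"
    using P(1) Q(1) Pz Qz by (auto simp: vpath_def)
  moreover have "length ((z # P2) @ Q1) \<ge> 3"
    using P2 Q1 by (cases P2; cases Q1) auto
  moreover have "last ((z # P2) @ Q1) \<rightarrow>\<^bsub>G\<^esub> hd ((z # P2) @ Q1)"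
    using Q(1) Qz(1) Q1 by (simp add: vpath_def vwalk_def vwalk_arcs_append)
  ultimately show False
    using acyclic unfolding undirected_cycle_def vpath_def by blast
qed

lemma acyclic_imp_axiom_JC:
  assumes acyclic: "\<nexists>C. undirected_cycle G C"
  shows "axiom_JC (verts G) (toll_transit G)"
  unfolding axiom_JC_def
proof (intro ballI impI)
  fix u x y v
  assume d: "distinct [u, x, y, v]" and x: "x \<in> toll_transit G u y"
    and y: "y \<in> toll_transit G x v" and "toll_transit G x y = {x, y}"
  then have xy: "x \<rightarrow>\<^bsub>G\<^esub> y"
    by (auto intro: toll_transit_eq_imp_adj)
  obtain P where P: "vpath P G" "hd P = u" "last P = x" "y \<notin> set P"
    using toll_transit_vpath_left[OF x _ xy] d by auto
  obtain Q where Q: "vpath Q G" "hd Q = y" "last Q = v" "x \<notin> set Q"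
    using toll_transit_vpath_right[OF y _ xy] d by auto
  have ne: "P \<noteq> []" "Q \<noteq> []"
    using P(1) Q(1) by (auto simp: vpath_def)
  have "set P \<inter> set Q = {}"
    using acyclic P Q xy by (intro acyclic_disjoint_vpaths)
  then have "vpath (P @ Q) G"
    using P Q xy by (auto simp: vpath_def intro: vwalk_append)
  moreover have "length (P @ Q) \<ge> 2"
    using ne by (cases P; cases Q) auto
  moreover have "x \<in> set (P @ Q)"
    using P ne by auto
  ultimately show "x \<in> toll_transit G u v"
    using P Q ne acyclic by (intro toll_transit_vpathI[of "P @ Q"]) auto
qed

lemma acyclic_connected_imp_axiom_tr:
  assumes acyclic: "\<nexists>C. undirected_cycle G C" and "connected G"
  shows "axiom_tr (verts G) (toll_transit G)"
  unfolding axiom_tr_def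
proof (intro ballI impI)
  fix u v x
  assume V: "u \<in> verts G" "v \<in> verts G" "x \<in> verts G" and "u \<noteq> v"
    and T: "toll_transit G u x = {u, x}" "toll_transit G x v = {x, v}"
  show "x \<in> toll_transit G u v"
  \<comment> \<open>The axiom lets \<open>x\<close> coincide with \<open>u\<close> or
    \<open>v\<close>; then \<open>x\<close> is an end of a path from \<open>u\<close> to
    \<open>v\<close>, which connectedness supplies.\<close>
  proof (cases "x = u \<or> x = v")
    case True
    have "u \<rightarrow>\<^sup>*\<^bsub>G\<^esub> v"
      using symmetric_connected_imp_strongly_connected[OF sym_arcs \<open>connected G\<close>] V
      by (auto simp: strongly_connected_def)
    then obtain P where P: "vpath P G" "hd P = u" "last P = v"
      by (auto simp: reachable_vpath_conv)
    then have "P \<noteq> []"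
      by (auto simp: vpath_def)
    moreover from this have "length P \<ge> 2"
      using P \<open>u \<noteq> v\<close> by (cases P; cases "tl P") auto
    ultimately show ?thesis
      using P acyclic True by (intro toll_transit_vpathI[of P]) auto
  next
    case False
    then have "u \<rightarrow>\<^bsub>G\<^esub> x" "x \<rightarrow>\<^bsub>G\<^esub> v"
      using T by (auto intro: toll_transit_eq_imp_adj)
    then have "vpath [u, x, v] G"
      using V \<open>u \<noteq> v\<close> False by (auto simp: vpath_def vwalk_def)
    then show ?thesis
      using acyclic by (intro toll_transit_vpathI[of "[u, x, v]"]) auto
  qed
qed

section \<open>From the axioms to acyclicity\<close>

lemma axioms_imp_acyclic:
  assumes JC: "axiom_JC (verts G) (toll_transit G)"
    and tr: "axiom_tr (verts G) (toll_transit G)"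
  shows "\<nexists>C. undirected_cycle G C"
proof
  assume "\<exists>C. undirected_cycle G C"
  then obtain C where C: "undirected_cycle G C"
    and min: "\<And>D. undirected_cycle G D \<Longrightarrow> length C \<le> length D"
    using ex_has_least_nat[of "undirected_cycle G" _ length] by blast
  have "length C \<ge> 3"
    using C by (simp add: undirected_cycle_def)
  then obtain u x y R where CR: "C = u # x # y # R"
    by (metis Suc_le_length_iff numeral_3_eq_3)
  have vp: "vpath C G" and vu: "last C \<rightarrow>\<^bsub>G\<^esub> u"
    using C CR by (auto simp: undirected_cycle_def)
  have ux: "u \<rightarrow>\<^bsub>G\<^esub> x" and xy: "x \<rightarrow>\<^bsub>G\<^esub> y"
    using vp CR by (auto simp: vpath_def)
  have V: "u \<in> verts G" "x \<in> verts G" "y \<in> verts G" "last C \<in> verts G"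
    using ux xy vu by (auto dest: adj_in_verts)
  show False
  proof (cases "R = []")
    case True
    then have "u \<noteq> y" "toll_transit G u y = {u, y}"
      using vp vu CR by (auto simp: vpath_def intro!: toll_transit_adj adj_sym)
    \<comment> \<open>In a triangle, (tr) puts \<open>x\<close> between the adjacent vertices
      \<open>u\<close> and \<open>y\<close>.\<close>
    then have "x \<in> {u, y}"
      using tr V toll_transit_adj[OF ux] toll_transit_adj[OF xy] unfolding axiom_tr_def by metis
    then show False
      using vp CR by (auto simp: vpath_def)
  next
    case False
    let ?v = "last C"
    have v: "?v = last R" "?v \<in> set R"
      using False CR by auto
    \<comment> \<open>The shortest cycle has \<open>length R + 3\<close> vertices, at least four, so
      both paths \<open>[u, x, y]\<close> and \<open>x # y # R\<close> are shorter than every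
      cycle.\<close>
    have long: "length D > length R + 2" "length D > length [u, x, y]" if "undirected_cycle G D" for D
      using min[OF that] CR False by (auto simp flip: length_greater_0_conv)
    have d: "distinct [u, x, y, ?v]"
      using vp CR v by (auto simp: vpath_def)
    have "vpath [u, x, y] G"
      using ux xy d V by (auto simp: vpath_def)
    then have "x \<in> toll_transit G u y"
      using long by (intro toll_transit_vpathI[of "[u, x, y]"]) auto
    moreover have "vpath (x # y # R) G"
      using vp CR by (auto simp: vpath_def)
    then have "y \<in> toll_transit G x ?v"
      using long v False by (intro toll_transit_vpathI[of "x # y # R"]) auto
    ultimately have "x \<in> toll_transit G u ?v"
      using JC V d toll_transit_adj[OF xy] unfolding axiom_JC_def by blast
    \<comment> \<open>The closing edge of the cycle makes the interval between its two ends trivial,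
      leaving no room for \<open>x\<close>.\<close>
    then show False
      using toll_transit_adj[OF adj_sym[OF vu]] d by auto
  qed
qed

end

theorem theorem6:
  fixes G :: "('a,'b) pre_digraph"
  assumes "graph G" and "connected G"
  shows "axiom_JC (verts G) (toll_transit G) \<and> axiom_tr (verts G) (toll_transit G)
         \<longleftrightarrow> undirected_tree G"
proof -
  interpret graph G by fact
  show ?thesis
    using acyclic_imp_axiom_JC acyclic_connected_imp_axiom_tr axioms_imp_acyclic assms(2)
    unfolding undirected_tree_def by blast
qed

end
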